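(* Let $\Gamma$ be a non-empty set and let $X\neq\{0\}$ and $Y\neq\{0\}$ be real Banach spaces such that $X$ is reflexive and $Y$ does not contain $c_{0}$ isomorphically. Then any continuous linear operator $T\colon c_{0}(\Gamma,X)\rightarrow Y$ is weakly compact.
   Context: $c_{0}(\Gamma,X)$ denotes the Banach space of functions $F\colon\Gamma\to X$ such that for each $\varepsilon>0$ the set $\{\gamma\in\Gamma:\|F(\gamma)\|\geq\varepsilon\}$ is finite, with the norm $\|F\|_\infty=\sup_{\gamma\in\Gamma}\|F(\gamma)\|$ (equivalently, $C_0(\Gamma,X)$ with $\Gamma$ regarded as a discrete topological space). $c_0$ is the space of real null sequences with the supremum norm; "$Y$ does not contain $c_0$ isomorphically" means that no linear subspace of $Y$ is linearly homeomorphic to $c_0$. An operator $T\colon Z\to Y$ is weakly compact if the norm closure $\overline{T(\mathbf{B}_Z)}$ of the image of the closed unit ball $\mathbf{B}_Z$ of $Z$ is weakly compact in $Y$. *)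

theory Defs
  imports "HOL-Analysis.Analysis"
begin

section \<open>The space of functions vanishing at infinity on a discrete index set\<close>

text \<open>The index set \<open>\<Gamma>\<close> is the universe of the type \<^typ>\<open>'g\<close>; it carries no topology and no cardinality
  restriction, and it is non-empty because all types are.\<close>

definition c0_set :: "('g \<Rightarrow> 'x::real_normed_vector) set" where
  "c0_set = {F. \<forall>e>0. finite {\<gamma>. norm (F \<gamma>) \<ge> e}}"

lemma c0_setD: "F \<in> c0_set \<Longrightarrow> e > 0 \<Longrightarrow> finite {\<gamma>. norm (F \<gamma>) \<ge> e}"
  by (simp add: c0_set_def)

lemma c0_set_zero: "(\<lambda>_. 0) \<in> c0_set"
  by (auto simp: c0_set_def)

lemma c0_set_add:
  assumes "F \<in> c0_set" "G \<in> c0_set"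
  shows "(\<lambda>\<gamma>. F \<gamma> + G \<gamma>) \<in> c0_set"
  unfolding c0_set_def
proof (intro CollectI allI impI)
  fix e :: real assume e: "e > 0"
  have "{\<gamma>. norm (F \<gamma> + G \<gamma>) \<ge> e} \<subseteq> {\<gamma>. norm (F \<gamma>) \<ge> e/2} \<union> {\<gamma>. norm (G \<gamma>) \<ge> e/2}"
  proof
    fix \<gamma> assume "\<gamma> \<in> {\<gamma>. norm (F \<gamma> + G \<gamma>) \<ge> e}"
    then show "\<gamma> \<in> {\<gamma>. norm (F \<gamma>) \<ge> e/2} \<union> {\<gamma>. norm (G \<gamma>) \<ge> e/2}"
      using norm_triangle_ineq[of "F \<gamma>" "G \<gamma>"] by auto
  qed
  moreover have "finite ({\<gamma>. norm (F \<gamma>) \<ge> e/2} \<union> {\<gamma>. norm (G \<gamma>) \<ge> e/2})"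
    using assms e by (intro finite_UnI c0_setD) auto
  ultimately show "finite {\<gamma>. norm (F \<gamma> + G \<gamma>) \<ge> e}"
    by (rule finite_subset)
qed

lemma c0_set_scaleR:
  assumes "F \<in> c0_set"
  shows "(\<lambda>\<gamma>. r *\<^sub>R F \<gamma>) \<in> c0_set"
proof (cases "r = 0")
  case True
  then show ?thesis by (simp add: c0_set_zero)
next
  case False
  show ?thesis
    unfolding c0_set_def
  proof (intro CollectI allI impI)
    fix e :: real assume "e > 0"
    then have "finite {\<gamma>. norm (F \<gamma>) \<ge> e / \<bar>r\<bar>}"
      using assms False by (simp add: c0_setD)
    then show "finite {\<gamma>. norm (r *\<^sub>R F \<gamma>) \<ge> e}"
      using False by (simp add: field_simps)
  qed
qed

lemma c0_set_uminus: "F \<in> c0_set \<Longrightarrow> (\<lambda>\<gamma>. - F \<gamma>) \<in> c0_set"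
  by (simp add: c0_set_def)

lemma c0_set_diff: "F \<in> c0_set \<Longrightarrow> G \<in> c0_set \<Longrightarrow> (\<lambda>\<gamma>. F \<gamma> - G \<gamma>) \<in> c0_set"
  using c0_set_add[of F "\<lambda>\<gamma>. - G \<gamma>"] c0_set_uminus[of G] by simp

lemma c0_set_bdd_above:
  assumes "F \<in> c0_set"
  shows "bdd_above (range (\<lambda>\<gamma>. norm (F \<gamma>)))"
proof -
  let ?A = "{\<gamma>. norm (F \<gamma>) \<ge> 1}"
  have "finite ?A" using assms by (simp add: c0_setD)
  then have "bdd_above ((\<lambda>\<gamma>. norm (F \<gamma>)) ` ?A)" by simp
  then obtain M where M: "\<And>\<gamma>. \<gamma> \<in> ?A \<Longrightarrow> norm (F \<gamma>) \<le> M"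
    by (auto simp: bdd_above_def)
  have "norm (F \<gamma>) \<le> max M 1" for \<gamma>
    using M[of \<gamma>] by (cases "\<gamma> \<in> ?A") auto
  then show ?thesis by (rule bdd_aboveI2)
qed

typedef (overloaded) ('g, 'x) c0 = "c0_set :: ('g \<Rightarrow> 'x::real_normed_vector) set"
  morphisms apply_c0 Abs_c0
  using c0_set_zero by blast

setup_lifting type_definition_c0

lemma c0_eqI: "(\<And>\<gamma>. apply_c0 F \<gamma> = apply_c0 G \<gamma>) \<Longrightarrow> F = G"
  by transfer auto

instantiation c0 :: (type, real_normed_vector) real_vector
begin

lift_definition zero_c0 :: "('a, 'b) c0" is "\<lambda>_. 0" by (rule c0_set_zero)

lift_definition plus_c0 :: "('a, 'b) c0 \<Rightarrow> ('a, 'b) c0 \<Rightarrow> ('a, 'b) c0"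
  is "\<lambda>F G \<gamma>. F \<gamma> + G \<gamma>" by (rule c0_set_add)

lift_definition uminus_c0 :: "('a, 'b) c0 \<Rightarrow> ('a, 'b) c0"
  is "\<lambda>F \<gamma>. - F \<gamma>" by (rule c0_set_uminus)

lift_definition minus_c0 :: "('a, 'b) c0 \<Rightarrow> ('a, 'b) c0 \<Rightarrow> ('a, 'b) c0"
  is "\<lambda>F G \<gamma>. F \<gamma> - G \<gamma>" by (rule c0_set_diff)

lift_definition scaleR_c0 :: "real \<Rightarrow> ('a, 'b) c0 \<Rightarrow> ('a, 'b) c0"
  is "\<lambda>r F \<gamma>. r *\<^sub>R F \<gamma>" by (rule c0_set_scaleR)

lemmas [simp] =
  zero_c0.rep_eq
  plus_c0.rep_eq
  uminus_c0.rep_eq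
  minus_c0.rep_eq
  scaleR_c0.rep_eq

instance
  by standard (auto intro!: c0_eqI simp: algebra_simps)

end

instantiation c0 :: (type, real_normed_vector) real_normed_vector
begin

lift_definition norm_c0 :: "('a, 'b) c0 \<Rightarrow> real" is "\<lambda>F. SUP \<gamma>. norm (F \<gamma>)" .

definition dist_c0 :: "('a, 'b) c0 \<Rightarrow> ('a, 'b) c0 \<Rightarrow> real"
  where "dist_c0 F G = norm (F - G)"

definition sgn_c0 :: "('a, 'b) c0 \<Rightarrow> ('a, 'b) c0"
  where "sgn_c0 F = F /\<^sub>R norm F"

definition uniformity_c0 :: "(('a, 'b) c0 \<times> ('a, 'b) c0) filter"
  where "uniformity_c0 = (INF e\<in>{0 <..}. principal {(F, G). dist F G < e})"

definition open_c0 :: "('a, 'b) c0 set \<Rightarrow> bool"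
  where "open_c0 S = (\<forall>F\<in>S. \<forall>\<^sub>F (F', G) in uniformity. F' = F \<longrightarrow> G \<in> S)"

lemma norm_apply_c0_le: "norm (apply_c0 F \<gamma>) \<le> norm F"
  by transfer (intro cSUP_upper c0_set_bdd_above, auto)

lemma norm_c0_le: "(\<And>\<gamma>. norm (apply_c0 F \<gamma>) \<le> b) \<Longrightarrow> norm F \<le> b"
  by transfer (simp add: cSUP_least)

instance
proof
  fix F G :: "('a, 'b) c0" and r :: real
  show "dist F G = norm (F - G)" by (rule dist_c0_def)
  show "sgn F = F /\<^sub>R norm F" by (rule sgn_c0_def)
  show "uniformity = (INF e\<in>{0 <..}. principal {(F, G :: ('a, 'b) c0). dist F G < e})"
    by (rule uniformity_c0_def)
  show "open S = (\<forall>F\<in>S. \<forall>\<^sub>F (F', G) in uniformity. F' = F \<longrightarrow> G \<in> S)" for S :: "('a, 'b) c0 set"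
    by (rule open_c0_def)
  show "norm F = 0 \<longleftrightarrow> F = 0"
  proof
    assume "norm F = 0"
    then have "norm (apply_c0 F \<gamma>) \<le> 0" for \<gamma>
      using norm_apply_c0_le[of F \<gamma>] by simp
    then show "F = 0" by (intro c0_eqI) simp
  qed (simp add: norm_c0.rep_eq)
  show "norm (F + G) \<le> norm F + norm G"
  proof (rule norm_c0_le)
    fix \<gamma>
    have "norm (apply_c0 (F + G) \<gamma>) \<le> norm (apply_c0 F \<gamma>) + norm (apply_c0 G \<gamma>)"
      by (simp add: norm_triangle_ineq)
    also have "\<dots> \<le> norm F + norm G"
      by (intro add_mono norm_apply_c0_le)
    finally show "norm (apply_c0 (F + G) \<gamma>) \<le> norm F + norm G" .
  qed
  show "norm (r *\<^sub>R F) = \<bar>r\<bar> * norm F"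
  proof (cases "r = 0")
    case True
    then show ?thesis by (simp add: norm_c0.rep_eq)
  next
    case False
    have le: "norm (s *\<^sub>R H) \<le> \<bar>s\<bar> * norm H" for s and H :: "('a, 'b) c0"
      by (rule norm_c0_le) (simp add: mult_left_mono norm_apply_c0_le)
    have "norm F = norm (inverse r *\<^sub>R (r *\<^sub>R F))" using False by simp
    also have "\<dots> \<le> \<bar>inverse r\<bar> * norm (r *\<^sub>R F)" by (rule le)
    finally have "\<bar>r\<bar> * norm F \<le> norm (r *\<^sub>R F)"
      using False by (simp add: field_simps)
    with le[of r F] show ?thesis by simp
  qed
qed

end

instance c0 :: (type, banach) banach
proof
  fix X :: "nat \<Rightarrow> ('a, 'b) c0"
  assume C: "Cauchy X"
  have le: "norm (apply_c0 (X m) \<gamma> - apply_c0 (X n) \<gamma>) \<le> norm (X m - X n)" for m n \<gamma>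
    using norm_apply_c0_le[of "X m - X n" \<gamma>] by simp
  have "Cauchy (\<lambda>n. apply_c0 (X n) \<gamma>)" for \<gamma>
  proof (rule CauchyI)
    fix e :: real assume "e > 0"
    then obtain M where "\<forall>m\<ge>M. \<forall>n\<ge>M. norm (X m - X n) < e"
      using CauchyD[OF C] by blast
    then show "\<exists>M. \<forall>m\<ge>M. \<forall>n\<ge>M. norm (apply_c0 (X m) \<gamma> - apply_c0 (X n) \<gamma>) < e"
      using le le_less_trans by blast
  qed
  then have "\<exists>l. (\<lambda>n. apply_c0 (X n) \<gamma>) \<longlonglongrightarrow> l" for \<gamma>
    by (simp add: Cauchy_convergent_iff convergent_def)
  then obtain L where L: "\<And>\<gamma>. (\<lambda>n. apply_c0 (X n) \<gamma>) \<longlonglongrightarrow> L \<gamma>"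
    by metis
  have unif: "\<exists>M. \<forall>m\<ge>M. \<forall>\<gamma>. norm (apply_c0 (X m) \<gamma> - L \<gamma>) \<le> e" if "e > 0" for e
  proof -
    obtain M where M: "\<forall>m\<ge>M. \<forall>n\<ge>M. norm (X m - X n) < e"
      using CauchyD[OF C \<open>e > 0\<close>] by blast
    have "norm (apply_c0 (X m) \<gamma> - L \<gamma>) \<le> e" if "m \<ge> M" for m \<gamma>
    proof (rule LIMSEQ_le_const2)
      show "(\<lambda>n. norm (apply_c0 (X m) \<gamma> - apply_c0 (X n) \<gamma>)) \<longlonglongrightarrow> norm (apply_c0 (X m) \<gamma> - L \<gamma>)"
        by (intro tendsto_intros L)
      show "\<exists>N. \<forall>n\<ge>N. norm (apply_c0 (X m) \<gamma> - apply_c0 (X n) \<gamma>) \<le> e"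
        using M that le[of m \<gamma>] by (meson le_less_trans less_imp_le)
    qed
    then show ?thesis by blast
  qed
  have "L \<in> c0_set"
    unfolding c0_set_def
  proof (intro CollectI allI impI)
    fix e :: real assume e: "e > 0"
    then obtain M where M: "\<And>\<gamma>. norm (apply_c0 (X M) \<gamma> - L \<gamma>) \<le> e/2"
      using unif[of "e/2"] by auto
    have "norm (apply_c0 (X M) \<gamma>) \<ge> e/2" if "norm (L \<gamma>) \<ge> e" for \<gamma>
      using M[of \<gamma>] that norm_triangle_sub[of "L \<gamma>" "apply_c0 (X M) \<gamma>"]
      by (simp add: norm_minus_commute)
    then have "{\<gamma>. norm (L \<gamma>) \<ge> e} \<subseteq> {\<gamma>. norm (apply_c0 (X M) \<gamma>) \<ge> e/2}" by auto
    moreover have "finite {\<gamma>. norm (apply_c0 (X M) \<gamma>) \<ge> e/2}"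
      using e by (intro c0_setD apply_c0) simp
    ultimately show "finite {\<gamma>. norm (L \<gamma>) \<ge> e}" by (rule finite_subset)
  qed
  then obtain F where F: "apply_c0 F = L"
    using Abs_c0_inverse by blast
  have "X \<longlonglongrightarrow> F"
  proof (rule LIMSEQ_I)
    fix e :: real assume e: "e > 0"
    then obtain M where M: "\<And>m \<gamma>. m \<ge> M \<Longrightarrow> norm (apply_c0 (X m) \<gamma> - L \<gamma>) \<le> e/2"
      using unif[of "e/2"] by auto
    have "norm (X m - F) < e" if "m \<ge> M" for m
    proof -
      have "norm (X m - F) \<le> e/2"
        by (rule norm_c0_le) (use M[OF that] in \<open>simp add: F\<close>)
      with e show ?thesis by simp
    qed
    then show "\<exists>M. \<forall>m\<ge>M. norm (X m - F) < e" by blast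
  qed
  then show "convergent X" by (rule convergentI)
qed

text \<open>For \<open>\<Gamma> = \<nat>\<close> and \<open>X = \<real>\<close> this is the classical space of real null sequences.\<close>

type_synonym null_seq = "(nat, real) c0"

lemma c0_set_nat_iff:
  fixes x :: "nat \<Rightarrow> 'x::real_normed_vector"
  shows "x \<in> c0_set \<longleftrightarrow> x \<longlonglongrightarrow> 0"
proof -
  have "x \<longlonglongrightarrow> 0 \<longleftrightarrow> (\<forall>e>0. \<forall>\<^sub>F n in cofinite. norm (x n) < e)"
    by (simp add: tendsto_iff cofinite_eq_sequentially)
  also have "\<dots> \<longleftrightarrow> x \<in> c0_set"
    by (simp add: eventually_cofinite c0_set_def not_less)
  finally show ?thesis by blast
qed


section \<open>Isomorphic copies, reflexivity and weak compactness\<close>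

definition contains_isomorphically ::
    "'y::real_normed_vector itself \<Rightarrow> 'z::real_normed_vector itself \<Rightarrow> bool" where
  "contains_isomorphically (_ :: 'y itself) (_ :: 'z itself) \<longleftrightarrow>
     (\<exists>(S :: 'y set) (f :: 'z \<Rightarrow> 'y) g. subspace S \<and> linear f \<and> homeomorphism UNIV S f g)"

lift_definition canonical_embedding ::
    "'x::real_normed_vector \<Rightarrow> (('x \<Rightarrow>\<^sub>L real) \<Rightarrow>\<^sub>L real)"
  is "\<lambda>x \<phi>. blinfun_apply \<phi> x"
  by (rule blinfun.bounded_linear_left)

definition reflexive_space :: "'x::real_normed_vector itself \<Rightarrow> bool" where
  "reflexive_space (_ :: 'x itself) \<longleftrightarrow> surj (canonical_embedding :: 'x \<Rightarrow> _)"

text \<open>The coarsest topology making all continuous linear functionals continuous.\<close>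

definition weak_topology :: "'y::real_normed_vector topology" where
  "weak_topology =
     topology_generated_by {blinfun_apply \<phi> -` U | (\<phi> :: 'y \<Rightarrow>\<^sub>L real) U. open U}"

lemma topspace_weak_topology [simp]: "topspace weak_topology = UNIV"
proof -
  have "UNIV = blinfun_apply (0 :: 'a \<Rightarrow>\<^sub>L real) -` UNIV" by simp
  then have "UNIV \<in> {blinfun_apply \<phi> -` U | (\<phi> :: 'a \<Rightarrow>\<^sub>L real) U. open U}" by blast
  then show ?thesis
    unfolding weak_topology_def topology_generated_by_topspace by blast
qed

definition weakly_compact_operator ::
    "('z::real_normed_vector \<Rightarrow> 'y::real_normed_vector) \<Rightarrow> bool" where
  "weakly_compact_operator T \<longleftrightarrow> compactin weak_topology (closure (T ` cball 0 1))"

end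

theory Submission
  imports Defs
begin

text \<open>
  For a function \<open>F\<close> from \<open>\<Gamma>\<close> into the unit ball of \<open>X\<close>, the vectors \<open>T (c0_single \<gamma> (F \<gamma>))\<close> form a
  weakly unconditionally Cauchy family in \<open>Y\<close>: all their finite combinations with coefficients in
  \<open>[-1, 1]\<close> are images under \<open>T\<close> of elements of the unit ball. By the theorem of Bessaga and Pelczynski,
  such a family is summable when \<open>Y\<close> contains no copy of \<open>c\<^sub>0\<close> (\<open>wuc_summable_on\<close>). Its sum depends on
  \<open>F\<close>, which extends \<open>T\<close> to all functions from \<open>\<Gamma>\<close> into the unit ball (\<open>bounded_extension\<close>).

  The set of these functions is a power of the unit ball of \<open>X\<close>. As \<open>X\<close> is reflexive, this ball is weakly
  compact (\<open>weakly_compact_cball_if_reflexive\<close>), so the power is compact in the product of the weak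
  topologies, by Tychonoff's theorem. The extension is continuous from this product to the weak topology of
  \<open>Y\<close> (\<open>continuous_map_bounded_extension\<close>), so its image is weakly compact, and then norm closed because
  the weak topology is Hausdorff and coarser than the norm topology. The image contains the image of the
  unit ball of \<open>c\<^sub>0(\<Gamma>, X)\<close>, and it consists of limits of such images, namely of the finite partial sums.
  So it is exactly the closure whose weak compactness is claimed.

  Two tools enter below this argument. One is the existence of norming functionals, a form of the
  Hahn--Banach theorem. The other is Rosenthal's disjointification lemma: from a sequence of vectors of norm
  at least \<open>\<epsilon>\<close> that is weakly unconditionally Cauchy, it selects a subsequence such that the functional
  norming one of its vectors has total mass at most \<open>\<epsilon> / 2\<close> on all the others. The closed span of such a
  subsequence is a copy of \<open>c\<^sub>0\<close>.
\<close>

section \<open>Norming functionals\<close>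

text \<open>Requiring only \<open>p (t x) \<le> t p x\<close> for \<open>t > 0\<close> keeps this easy to verify; applied to \<open>1 / t\<close> it
  gives equality.\<close>

definition sublinear :: "('a::real_vector \<Rightarrow> real) \<Rightarrow> bool" where
  "sublinear p \<longleftrightarrow> (\<forall>x y. p (x + y) \<le> p x + p y) \<and> (\<forall>x t. t > 0 \<longrightarrow> p (t *\<^sub>R x) \<le> t * p x)"

lemma sublinear_add: "sublinear p \<Longrightarrow> p (x + y) \<le> p x + p y"
  by (simp add: sublinear_def)

lemma sublinear_scaleR:
  assumes "sublinear p" "t > 0"
  shows "p (t *\<^sub>R x) = t * p x"
proof (rule antisym)
  show "p (t *\<^sub>R x) \<le> t * p x" using assms by (simp add: sublinear_def)
  have "p ((1 / t) *\<^sub>R (t *\<^sub>R x)) \<le> (1 / t) * p (t *\<^sub>R x)"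
    using assms unfolding sublinear_def by (metis zero_less_divide_1_iff)
  then show "t * p x \<le> p (t *\<^sub>R x)" using assms by (simp add: field_simps)
qed

lemma sublinear_zero:
  assumes "sublinear p"
  shows "p 0 = 0"
  using sublinear_scaleR[OF assms, of 2 0] by simp

lemma sublinear_minus: "sublinear p \<Longrightarrow> - p (- x) \<le> p x"
  using sublinear_add[of p x "- x"] by (simp add: sublinear_zero)

lemma sublinear_norm: "sublinear (norm :: 'a::real_normed_vector \<Rightarrow> real)"
  by (simp add: sublinear_def norm_triangle_ineq)

text \<open>A sublinear functional \<open>p\<close> can be lowered at \<open>- x\<close> to the value \<open>- p x\<close>, which is the least
  value that subadditivity permits. This single step replaces the one-dimensional extension step of
  the usual proof of the Hahn--Banach theorem.\<close>

lemma sublinear_tilt: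
  fixes x :: "'a::real_vector"
  assumes p: "sublinear p"
  obtains q where "sublinear q" "\<And>y. q y \<le> p y" "\<And>y. q y \<le> p (y + x) - p x"
proof -
  define S where "S y = (\<lambda>t. p (y + t *\<^sub>R x) - t * p x) ` {0..}" for y
  define q where "q y = Inf (S y)" for y
  have S_ne: "S y \<noteq> {}" for y by (auto simp: S_def)
  have "- p (- y) \<le> p (y + t *\<^sub>R x) - t * p x" if "t \<ge> 0" for y t
  proof -
    have "p (t *\<^sub>R x) \<le> p (y + t *\<^sub>R x) + p (- y)"
      using sublinear_add[OF p, of "y + t *\<^sub>R x" "- y"] by simp
    moreover have "p (t *\<^sub>R x) = t * p x"
      using that sublinear_scaleR[OF p, of t x] sublinear_zero[OF p] by (cases "t = 0") auto
    ultimately show ?thesis by simp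
  qed
  then have bdd: "bdd_below (S y)" for y
    unfolding S_def by (intro bdd_belowI2[where m = "- p (- y)"]) auto
  have q_le: "q y \<le> p (y + t *\<^sub>R x) - t * p x" if "t \<ge> 0" for y t
    unfolding q_def by (rule cInf_lower[OF _ bdd]) (use that in \<open>auto simp: S_def\<close>)
  have q_ge: "c \<le> q y" if "\<And>t. t \<ge> 0 \<Longrightarrow> c \<le> p (y + t *\<^sub>R x) - t * p x" for c y
    unfolding q_def by (rule cInf_greatest[OF S_ne]) (use that in \<open>auto simp: S_def\<close>)
  have "sublinear q"
    unfolding sublinear_def
  proof (intro conjI allI impI)
    fix y z
    have "q (y + z) - (p (z + t *\<^sub>R x) - t * p x) \<le> p (y + s *\<^sub>R x) - s * p x"
      if "s \<ge> 0" "t \<ge> 0" for s t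
    proof -
      have "q (y + z) \<le> p ((y + s *\<^sub>R x) + (z + t *\<^sub>R x)) - (s + t) * p x"
        using q_le[of "s + t" "y + z"] that by (simp add: algebra_simps)
      then show ?thesis
        using sublinear_add[OF p, of "y + s *\<^sub>R x" "z + t *\<^sub>R x"] by (simp add: algebra_simps)
    qed
    then have "q (y + z) - (p (z + t *\<^sub>R x) - t * p x) \<le> q y" if "t \<ge> 0" for t
      using that by (intro q_ge) auto
    then have "q (y + z) - q y \<le> q z"
      by (intro q_ge) (smt (verit))
    then show "q (y + z) \<le> q y + q z" by simp
  next
    fix y and t :: real assume t: "t > 0"
    have "q (t *\<^sub>R y) / t \<le> q y"
    proof (rule q_ge)
      fix s :: real assume "s \<ge> 0"
      then have "q (t *\<^sub>R y) \<le> p (t *\<^sub>R (y + s *\<^sub>R x)) - (t * s) * p x"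
        using q_le[of "t * s" "t *\<^sub>R y"] t by (simp add: algebra_simps)
      also have "\<dots> = t * (p (y + s *\<^sub>R x) - s * p x)"
        using sublinear_scaleR[OF p t, of "y + s *\<^sub>R x"] by (simp add: algebra_simps)
      finally show "q (t *\<^sub>R y) / t \<le> p (y + s *\<^sub>R x) - s * p x"
        using t by (simp add: field_simps)
    qed
    then show "q (t *\<^sub>R y) \<le> t * q y" using t by (simp add: field_simps)
  qed
  moreover have "q y \<le> p y" "q y \<le> p (y + x) - p x" for y
    using q_le[of 0 y] q_le[of 1 y] by simp_all
  ultimately show ?thesis by (rule that)
qed

text \<open>A minimal sublinear functional cannot be lowered by the preceding step, and this says that it
  is superadditive.\<close>

lemma linear_minimal_sublinear:
  assumes m: "sublinear m" and min: "\<And>q. sublinear q \<Longrightarrow> (\<And>y. q y \<le> m y) \<Longrightarrow> q = m"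
  shows "linear m"
proof -
  have "m x + m y \<le> m (x + y)" for x y
  proof -
    obtain q where q: "sublinear q" "\<And>y. q y \<le> m y" "\<And>y. q y \<le> m (y + x) - m x"
      using sublinear_tilt[OF m, of x] by blast
    then have "q = m" by (intro min)
    with q(3)[of y] show ?thesis by (simp add: add.commute)
  qed
  then have add: "m (x + y) = m x + m y" for x y
    using sublinear_add[OF m] by (intro antisym)
  have neg: "m (- x) = - m x" for x
    using add[of x "- x"] sublinear_zero[OF m] by simp
  have "m (t *\<^sub>R x) = t * m x" for t x
  proof -
    consider "t = 0" | "t > 0" | "- t > 0" by linarith
    then show ?thesis
    proof cases
      case 3
      then show ?thesis
        using sublinear_scaleR[OF m 3, of x] neg[of "t *\<^sub>R x"] by simp
    qed (use m sublinear_scaleR sublinear_zero in auto)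
  qed
  with add show ?thesis by (intro linearI) auto
qed

text \<open>Minimal sublinear functionals exist by Zorn's lemma, because the pointwise infimum of a chain
  is sublinear.\<close>

lemma linear_below_sublinear:
  fixes p :: "'a::real_vector \<Rightarrow> real"
  assumes p: "sublinear p"
  obtains f where "linear f" "\<And>x. f x \<le> p x"
proof -
  define A where "A = {q. sublinear q \<and> (\<forall>x. q x \<le> p x)}"
  define P where "P = (\<lambda>a b :: 'a \<Rightarrow> real. b \<le> a)"
  have "\<exists>m\<in>A. \<forall>a\<in>A. P m a \<longrightarrow> a = m"
  proof (rule predicate_Zorn)
    show "partial_order_on A (relation_of P A)"
      by (rule partial_order_on_relation_ofI) (auto simp: P_def)
  next
    fix C assume C: "C \<in> Chains (relation_of P A)"
    then have CA: "C \<subseteq> A" by (rule Chains_relation_of)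
    have chain: "a \<le> b \<or> b \<le> a" if "a \<in> C" "b \<in> C" for a b
      using C that unfolding Chains_def relation_of_def P_def by blast
    show "\<exists>u\<in>A. \<forall>a\<in>C. P a u"
    proof (cases "C = {}")
      case True
      then show ?thesis using p by (auto simp: A_def)
    next
      case False
      define u where "u x = (INF a\<in>C. a x)" for x
      have "- p (- x) \<le> a x" if "a \<in> C" for a x
      proof -
        have "sublinear a" "a (- x) \<le> p (- x)" using that CA by (auto simp: A_def)
        then show ?thesis using sublinear_minus[of a x] by simp
      qed
      then have bdd: "bdd_below ((\<lambda>a. a x) ` C)" for x
        by (rule bdd_belowI2)
      have u_le: "u x \<le> a x" if "a \<in> C" for a x
        unfolding u_def using that by (rule cINF_lower[OF bdd])
      have u_ge: "c \<le> u x" if "\<And>a. a \<in> C \<Longrightarrow> c \<le> a x" for c x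
        unfolding u_def using False that by (rule cINF_greatest)
      have "sublinear u"
        unfolding sublinear_def
      proof (intro conjI allI impI)
        fix x y
        have "u (x + y) - b y \<le> a x" if ab: "a \<in> C" "b \<in> C" for a b
        proof -
          obtain c where c: "c \<in> C" "c \<le> a" "c \<le> b"
            using chain[OF ab] ab by blast
          have "u (x + y) \<le> c x + c y"
            using u_le[OF c(1)] sublinear_add[of c x y] c(1) CA
            by (force simp: A_def intro: order_trans)
          then show ?thesis using c(2,3)[THEN le_funD] by (smt (verit))
        qed
        then have "u (x + y) - b y \<le> u x" if "b \<in> C" for b
          using that by (intro u_ge)
        then have "u (x + y) - u x \<le> u y"
          by (intro u_ge) (smt (verit))
        then show "u (x + y) \<le> u x + u y" by simp
      next
        fix x and t :: real assume t: "t > 0"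
        have "u (t *\<^sub>R x) / t \<le> u x"
        proof (rule u_ge)
          fix a assume a: "a \<in> C"
          then have "u (t *\<^sub>R x) \<le> t * a x"
            using u_le[OF a, of "t *\<^sub>R x"] sublinear_scaleR[of a t x] CA t by (auto simp: A_def)
          then show "u (t *\<^sub>R x) / t \<le> a x" using t by (simp add: field_simps)
        qed
        then show "u (t *\<^sub>R x) \<le> t * u x" using t by (simp add: field_simps)
      qed
      moreover have "u x \<le> p x" for x
        using False u_le CA by (force simp: A_def intro: order_trans)
      ultimately have "u \<in> A" by (simp add: A_def)
      then show ?thesis using u_le by (auto simp: P_def le_fun_def)
    qed
  qed
  then obtain m where m: "m \<in> A" and min: "\<And>a. a \<in> A \<Longrightarrow> a \<le> m \<Longrightarrow> a = m"
    by (auto simp: P_def)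
  have "linear m"
  proof (rule linear_minimal_sublinear)
    show "sublinear m" using m by (simp add: A_def)
    fix q assume "sublinear q" and le: "\<And>y. q y \<le> m y"
    moreover have "q y \<le> p y" for y
      using le[of y] m by (auto simp: A_def intro: order_trans)
    ultimately show "q = m" by (intro min) (auto simp: A_def le_fun_def)
  qed
  with m show ?thesis using that by (auto simp: A_def)
qed

text \<open>A linear functional below the norm, lowered first to \<open>- norm x\<close> at \<open>- x\<close>, norms \<open>x\<close>.\<close>

theorem norming_functional:
  fixes x :: "'a::real_normed_vector"
  obtains \<phi> :: "'a \<Rightarrow>\<^sub>L real" where "\<And>y. \<bar>\<phi> y\<bar> \<le> norm y" "\<phi> x = norm x"
proof -
  obtain q :: "'a \<Rightarrow> real" where q: "sublinear q" "\<And>y. q y \<le> norm y" "\<And>y. q y \<le> norm (y + x) - norm x"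
    using sublinear_tilt[OF sublinear_norm, of x] by blast
  obtain f where f: "linear f" "\<And>y. f y \<le> q y"
    using linear_below_sublinear[OF q(1)] by blast
  have f_minus: "f (- y) = - f y" for y by (rule linear_neg[OF f(1)])
  have f_le: "f y \<le> norm y" for y using f(2) q(2) order_trans by blast
  have abs: "\<bar>f y\<bar> \<le> norm y" for y
    using f_le[of y] f_le[of "- y"] by (simp add: f_minus)
  have "bounded_linear f"
    using f(1) abs by (intro bounded_linear_intro[where K = 1]) (auto simp: linear_add linear_scale)
  then have "blinfun_apply (Blinfun f) = f" by (rule bounded_linear_Blinfun_apply)
  moreover have "f x = norm x"
    using f(2)[of "- x"] q(3)[of "- x"] f_le[of x] by (simp add: f_minus)
  ultimately show ?thesis using abs by (intro that[of "Blinfun f"]) auto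
qed

section \<open>Weakly unconditionally Cauchy families and copies of \<open>c\<^sub>0\<close>\<close>

text \<open>The usual definition asks that \<open>\<Sum>i. \<bar>\<phi> (y i)\<bar> < \<infinity>\<close> for every continuous linear functional
  \<open>\<phi>\<close>. By the uniform boundedness principle this amounts to the following bound, which is the form in
  which the property is both verified and used below.\<close>

definition wuc :: "('i \<Rightarrow> 'y::real_normed_vector) \<Rightarrow> bool" where
  "wuc y \<longleftrightarrow> (\<exists>C. \<forall>A a. finite A \<longrightarrow> (\<forall>i\<in>A. \<bar>a i\<bar> \<le> 1) \<longrightarrow> norm (\<Sum>i\<in>A. a i *\<^sub>R y i) \<le> C)"

lemma wucI:
  assumes "\<And>A a. finite A \<Longrightarrow> (\<And>i. i \<in> A \<Longrightarrow> \<bar>a i\<bar> \<le> 1) \<Longrightarrow> norm (\<Sum>i\<in>A. a i *\<^sub>R y i) \<le> C"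
  shows "wuc y"
  using assms unfolding wuc_def by blast

lemma wucE:
  assumes "wuc y"
  obtains C where "C \<ge> 0"
    "\<And>A a b. finite A \<Longrightarrow> b \<ge> 0 \<Longrightarrow> (\<And>i. i \<in> A \<Longrightarrow> \<bar>a i\<bar> \<le> b) \<Longrightarrow> norm (\<Sum>i\<in>A. a i *\<^sub>R y i) \<le> C * b"
proof -
  obtain C where C: "\<And>A a. finite A \<Longrightarrow> (\<forall>i\<in>A. \<bar>a i\<bar> \<le> 1) \<Longrightarrow> norm (\<Sum>i\<in>A. a i *\<^sub>R y i) \<le> C"
    using assms unfolding wuc_def by blast
  have "C \<ge> 0" using C[of "{}"] by simp
  moreover have "norm (\<Sum>i\<in>A. a i *\<^sub>R y i) \<le> C * b"
    if A: "finite A" and b: "b \<ge> 0" and a: "\<And>i. i \<in> A \<Longrightarrow> \<bar>a i\<bar> \<le> b" for A a b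
  proof (cases "b = 0")
    case True
    then show ?thesis using a by simp
  next
    case False
    with b have b: "b > 0" by simp
    have "norm (\<Sum>i\<in>A. (a i / b) *\<^sub>R y i) \<le> C"
      using a b by (intro C A) auto
    also have "(\<Sum>i\<in>A. (a i / b) *\<^sub>R y i) = (1 / b) *\<^sub>R (\<Sum>i\<in>A. a i *\<^sub>R y i)"
      by (simp add: scaleR_sum_right)
    finally show ?thesis using b by (simp add: field_simps)
  qed
  ultimately show ?thesis by (rule that)
qed

lemma wuc_reindex:
  fixes r :: "'n \<Rightarrow> 'i"
  assumes "wuc y" "inj r"
  shows "wuc (\<lambda>n. y (r n))"
proof -
  obtain C where C: "\<And>A a b. finite A \<Longrightarrow> b \<ge> 0 \<Longrightarrow> (\<And>i. i \<in> A \<Longrightarrow> \<bar>a i\<bar> \<le> b) \<Longrightarrow>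
      norm (\<Sum>i\<in>A. a i *\<^sub>R y i) \<le> C * b"
    using wucE[OF assms(1)] by metis
  show ?thesis
  proof (rule wucI[where C = "C * 1"])
    fix A and a :: "'n \<Rightarrow> real" assume A: "finite A" "\<And>n. n \<in> A \<Longrightarrow> \<bar>a n\<bar> \<le> 1"
    have "(\<Sum>n\<in>A. a n *\<^sub>R y (r n)) = (\<Sum>i\<in>r ` A. a (inv r i) *\<^sub>R y i)"
      using assms(2) by (subst sum.reindex) (auto intro: inj_on_subset)
    also have "norm \<dots> \<le> C * 1"
      using A assms(2) by (intro C) auto
    finally show "norm (\<Sum>n\<in>A. a n *\<^sub>R y (r n)) \<le> C * 1" .
  qed
qed

lemma wuc_block_sums:
  fixes D :: "'n \<Rightarrow> 'i set"
  assumes "wuc y" and fin: "\<And>n. finite (D n)" and disj: "disjoint_family D"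
  shows "wuc (\<lambda>n. sum y (D n))"
proof -
  obtain C where C: "\<And>A a b. finite A \<Longrightarrow> b \<ge> 0 \<Longrightarrow> (\<And>i. i \<in> A \<Longrightarrow> \<bar>a i\<bar> \<le> b) \<Longrightarrow>
      norm (\<Sum>i\<in>A. a i *\<^sub>R y i) \<le> C * b"
    using wucE[OF assms(1)] by metis
  define block where "block i = (THE n. i \<in> D n)" for i
  have block: "block i = n" if "i \<in> D n" for i n
    unfolding block_def using that disj by (intro the_equality) (auto simp: disjoint_family_on_def)
  show ?thesis
  proof (rule wucI[where C = "C * 1"])
    fix N and a :: "'n \<Rightarrow> real" assume N: "finite N" "\<And>n. n \<in> N \<Longrightarrow> \<bar>a n\<bar> \<le> 1"
    have "(\<Sum>n\<in>N. a n *\<^sub>R sum y (D n)) = (\<Sum>n\<in>N. \<Sum>i\<in>D n. a (block i) *\<^sub>R y i)"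
      by (simp add: block scaleR_sum_right)
    also have "\<dots> = (\<Sum>i\<in>(\<Union>n\<in>N. D n). a (block i) *\<^sub>R y i)"
      using N fin disj by (intro sum.UNION_disjoint[symmetric]) (auto simp: disjoint_family_on_def)
    also have "norm \<dots> \<le> C * 1"
      using N fin by (intro C) (auto simp: block)
    finally show "norm (\<Sum>n\<in>N. a n *\<^sub>R sum y (D n)) \<le> C * 1" .
  qed
qed

text \<open>This is Rosenthal's disjointification lemma. Split the index set into infinitely many infinite
  parts. If no part serves as the range of \<open>r\<close>, each part contains a row whose mass on the rest of
  its part exceeds \<open>d\<close>. Choose one such row from each part: restricted to the chosen indices, its
  mass has dropped by more than \<open>d\<close>. As the masses are at most \<open>N d\<close>, this can happen at most \<open>N\<close>
  times.\<close>

lemma disjointification: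
  fixes m :: "nat \<Rightarrow> nat \<Rightarrow> real"
  assumes "d \<ge> 0" and "\<And>n k. m n k \<ge> 0"
    and "\<And>n A. finite A \<Longrightarrow> n \<notin> A \<Longrightarrow> (\<Sum>k\<in>A. m n k) \<le> real N * d"
  shows "\<exists>r :: nat \<Rightarrow> nat. inj r \<and> (\<forall>n A. finite A \<longrightarrow> n \<notin> A \<longrightarrow> (\<Sum>k\<in>A. m (r n) (r k)) \<le> d)"
  using assms(2,3)
proof (induction N arbitrary: m)
  case 0
  then have "(\<Sum>k\<in>A. m n k) \<le> d" if "finite A" "n \<notin> A" for n A
    using "0.prems"(2)[OF that] \<open>d \<ge> 0\<close> by simp
  then show ?case by (intro exI[of _ id]) auto
next
  case (Suc N)
  define e where "e p i = prod_encode (p, i)" for p i :: nat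
  have e_eq: "e p i = e q j \<longleftrightarrow> p = q \<and> i = j" for p q i j by (simp add: e_def)
  show ?case
  proof (cases "\<exists>p. \<forall>i A. finite A \<longrightarrow> i \<notin> A \<longrightarrow> (\<Sum>k\<in>A. m (e p i) (e p k)) \<le> d")
    case True
    then obtain p where "\<forall>i A. finite A \<longrightarrow> i \<notin> A \<longrightarrow> (\<Sum>k\<in>A. m (e p i) (e p k)) \<le> d" ..
    moreover have "inj (e p)" by (simp add: inj_def e_eq)
    ultimately show ?thesis by blast
  next
    case False
    then have "\<forall>p. \<exists>i A. finite A \<and> i \<notin> A \<and> (\<Sum>k\<in>A. m (e p i) (e p k)) > d"
      by (meson not_le)
    then obtain i A where iA: "\<And>p. finite (A p)" "\<And>p. i p \<notin> A p"
        "\<And>p. (\<Sum>k\<in>A p. m (e p (i p)) (e p k)) > d"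
      by metis
    define s where "s p = e p (i p)" for p
    have "inj s" by (simp add: inj_def s_def e_eq)
    have "(\<Sum>q\<in>B. m (s p) (s q)) \<le> real N * d" if B: "finite B" "p \<notin> B" for p B
    proof -
      have "(\<Sum>q\<in>B. m (s p) (s q)) = (\<Sum>k\<in>s ` B. m (s p) k)"
        using \<open>inj s\<close> by (subst sum.reindex) (auto intro: inj_on_subset)
      moreover have "(\<Sum>k\<in>A p. m (s p) (e p k)) = (\<Sum>k\<in>e p ` A p. m (s p) k)"
        by (subst sum.reindex) (auto simp: inj_on_def e_eq)
      moreover have "(\<Sum>k\<in>s ` B. m (s p) k) + (\<Sum>k\<in>e p ` A p. m (s p) k) =
          (\<Sum>k\<in>s ` B \<union> e p ` A p. m (s p) k)"
        using B iA(1) by (intro sum.union_disjoint[symmetric]) (auto simp: s_def e_eq)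
      moreover have "\<dots> \<le> real (Suc N) * d"
        using B iA(1,2) by (intro Suc.prems) (auto simp: s_def e_eq)
      ultimately show ?thesis using iA(3)[of p] by (simp add: s_def algebra_simps)
    qed
    then obtain r :: "nat \<Rightarrow> nat" where "inj r" "\<forall>n A. finite A \<longrightarrow> n \<notin> A \<longrightarrow> (\<Sum>k\<in>A. m (s (r n)) (s (r k))) \<le> d"
      using Suc.IH[of "\<lambda>p q. m (s p) (s q)"] Suc.prems(1) by blast
    moreover from \<open>inj s\<close> \<open>inj r\<close> have "inj (s \<circ> r)" by (rule inj_compose)
    ultimately show ?thesis by (intro exI[of _ "s \<circ> r"] conjI) (simp_all add: o_def)
  qed
qed

lemma contains_isomorphicallyI:
  fixes S :: "'z::real_normed_vector \<Rightarrow> 'y::real_normed_vector"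
  assumes S: "bounded_linear S" and c: "c > 0" and below: "\<And>x. c * norm x \<le> norm (S x)"
  shows "contains_isomorphically TYPE('y) TYPE('z)"
proof -
  interpret bounded_linear S by fact
  have inv: "c * dist x x' \<le> dist (S x) (S x')" for x x'
    using below[of "x - x'"] by (simp add: dist_norm diff)
  then have "inj S"
    using c by (intro injI) (metis dist_self dist_eq_0_iff mult_pos_pos not_le zero_less_dist_iff)
  have "continuous_on (range S) (inv S)"
    unfolding continuous_on_iff
  proof (intro ballI allI impI)
    fix y e assume y: "y \<in> range S" and e: "(0::real) < e"
    then obtain x where x: "y = S x" by blast
    show "\<exists>d>0. \<forall>y'\<in>range S. dist y' y < d \<longrightarrow> dist (inv S y') (inv S y) < e"
    proof (intro exI[of _ "c * e"] conjI ballI impI)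
      fix y' assume "y' \<in> range S" and less: "dist y' y < c * e"
      then obtain x' where x': "y' = S x'" by blast
      have "c * dist x' x < c * e" using inv[of x' x] less x x' by simp
      then show "dist (inv S y') (inv S y) < e"
        using c \<open>inj S\<close> by (simp add: x x')
    qed (use c e in simp)
  qed
  moreover have "continuous_on UNIV S" by (intro linear_continuous_on S)
  ultimately have "homeomorphism UNIV (range S) S (inv S)"
    using \<open>inj S\<close> by (auto simp: homeomorphism_def inj_imp_surj_inv)
  moreover have "subspace (range S)"
    using linear_axioms subspace_UNIV by (metis linear_subspace_image)
  ultimately show ?thesis
    unfolding contains_isomorphically_def using linear_axioms by blast
qed

text \<open>This is a theorem of Bessaga and Pelczynski. The operator \<open>a \<mapsto> \<Sum>k. a k y k\<close> from \<open>c\<^sub>0\<close> is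
  bounded. Let \<open>\<phi> n\<close> norm \<open>y n\<close>. After disjointification, \<open>\<phi> n\<close> evaluated at the series is
  \<open>a n (norm (y n))\<close> up to an error of at most \<open>\<epsilon> / 2\<close> times the norm of \<open>a\<close>. Taking the
  supremum over \<open>n\<close> bounds the operator from below by \<open>\<epsilon> / 2\<close> times the norm of \<open>a\<close>.\<close>

theorem contains_c0_if_wuc:
  fixes y :: "nat \<Rightarrow> 'y::banach"
  assumes y: "wuc y" and \<epsilon>: "\<epsilon> > 0" and below: "\<And>n. norm (y n) \<ge> \<epsilon>"
  shows "contains_isomorphically TYPE('y) TYPE(null_seq)"
proof -
  obtain C where C: "C \<ge> 0" "\<And>A a b. finite A \<Longrightarrow> b \<ge> 0 \<Longrightarrow> (\<And>i. i \<in> A \<Longrightarrow> \<bar>a i\<bar> \<le> b) \<Longrightarrow>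
      norm (\<Sum>i\<in>A. a i *\<^sub>R y i) \<le> C * b"
    using wucE[OF y] by metis
  have "\<exists>\<phi> :: 'y \<Rightarrow>\<^sub>L real. (\<forall>v. \<bar>\<phi> v\<bar> \<le> norm v) \<and> \<phi> (y n) = norm (y n)" for n
    using norming_functional[of "y n"] by metis
  then obtain \<phi> :: "nat \<Rightarrow> 'y \<Rightarrow>\<^sub>L real"
    where \<phi>_le: "\<And>n v. \<bar>\<phi> n v\<bar> \<le> norm v" and \<phi>_eq: "\<And>n. \<phi> n (y n) = norm (y n)"
    by metis
  have row: "(\<Sum>k\<in>A. \<bar>\<phi> n (y k)\<bar>) \<le> C" if "finite A" for n A
  proof -
    have "(\<Sum>k\<in>A. \<bar>\<phi> n (y k)\<bar>) = \<phi> n (\<Sum>k\<in>A. sgn (\<phi> n (y k)) *\<^sub>R y k)"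
      by (simp add: blinfun.sum_right blinfun.scaleR_right abs_sgn mult.commute)
    also have "\<dots> \<le> norm (\<Sum>k\<in>A. sgn (\<phi> n (y k)) *\<^sub>R y k)"
      using \<phi>_le abs_le_D1 by blast
    also have "\<dots> \<le> C * 1"
      using that by (intro C(2)) (auto simp: abs_sgn_eq)
    finally show ?thesis by simp
  qed
  obtain N :: nat where N: "C / (\<epsilon> / 2) \<le> real N" using real_arch_simple by blast
  have "\<exists>r :: nat \<Rightarrow> nat. inj r \<and> (\<forall>n A. finite A \<longrightarrow> n \<notin> A \<longrightarrow> (\<Sum>k\<in>A. \<bar>\<phi> (r n) (y (r k))\<bar>) \<le> \<epsilon> / 2)"
  proof (rule disjointification)
    fix n :: nat and A :: "nat set" assume "finite A"
    then show "(\<Sum>k\<in>A. \<bar>\<phi> n (y k)\<bar>) \<le> real N * (\<epsilon> / 2)"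
      using row[of A n] N \<epsilon> by (simp add: field_simps)
  qed (use \<epsilon> in auto)
  then obtain r :: "nat \<Rightarrow> nat" where r: "inj r"
    "\<And>n A. finite A \<Longrightarrow> n \<notin> A \<Longrightarrow> (\<Sum>k\<in>A. \<bar>\<phi> (r n) (y (r k))\<bar>) \<le> \<epsilon> / 2"
    by blast
  define z where "z k = y (r k)" for k
  have "wuc z" using wuc_reindex[OF y r(1)] by (simp add: z_def [abs_def])
  obtain D where D: "D \<ge> 0" "\<And>A a b. finite A \<Longrightarrow> b \<ge> 0 \<Longrightarrow> (\<And>i. i \<in> A \<Longrightarrow> \<bar>a i\<bar> \<le> b) \<Longrightarrow>
      norm (\<Sum>i\<in>A. a i *\<^sub>R z i) \<le> D * b"
    using wucE[OF \<open>wuc z\<close>] by metis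
  have abs_le: "\<bar>apply_c0 a k\<bar> \<le> norm a" for a :: null_seq and k
    using norm_apply_c0_le[of a k] by simp
  have summ: "summable (\<lambda>k. apply_c0 a k *\<^sub>R z k)" for a :: null_seq
    unfolding summable_Cauchy
  proof (intro allI impI)
    fix e :: real assume e: "e > 0"
    define \<delta> where "\<delta> = e / (D + 1)"
    have \<delta>: "\<delta> > 0" "D * \<delta> < e" using e D(1) by (auto simp: \<delta>_def field_simps)
    have "finite {k. norm (apply_c0 a k) \<ge> \<delta>}" using \<delta>(1) by (intro c0_setD apply_c0)
    then obtain M where M: "\<And>k. \<bar>apply_c0 a k\<bar> \<ge> \<delta> \<Longrightarrow> k < M"
      using finite_nat_set_iff_bounded by auto
    have "norm (\<Sum>k\<in>{m..<n}. apply_c0 a k *\<^sub>R z k) < e" if "m \<ge> M" for m n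
    proof -
      have "norm (\<Sum>k\<in>{m..<n}. apply_c0 a k *\<^sub>R z k) \<le> D * \<delta>"
      proof (rule D(2))
        fix k assume "k \<in> {m..<n}"
        then show "\<bar>apply_c0 a k\<bar> \<le> \<delta>" using M[of k] that by force
      qed (use \<delta> in auto)
      with \<delta>(2) show ?thesis by simp
    qed
    then show "\<exists>M. \<forall>m\<ge>M. \<forall>n. norm (\<Sum>k\<in>{m..<n}. apply_c0 a k *\<^sub>R z k) < e" by blast
  qed
  define S :: "null_seq \<Rightarrow> 'y" where "S a = (\<Sum>k. apply_c0 a k *\<^sub>R z k)" for a
  have lim: "(\<lambda>M. \<Sum>k<M. apply_c0 a k *\<^sub>R z k) \<longlonglongrightarrow> S a" for a :: null_seq
    unfolding S_def by (rule summable_LIMSEQ[OF summ])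
  have "bounded_linear S"
  proof (rule bounded_linear_intro[where K = D])
    fix a b :: null_seq and t :: real
    show "S (a + b) = S a + S b"
      unfolding S_def by (simp add: scaleR_add_left suminf_add[OF summ summ])
    show "S (t *\<^sub>R a) = t *\<^sub>R S a"
      unfolding S_def by (simp add: suminf_scaleR_right[OF summ])
    show "norm (S a) \<le> norm a * D"
    proof (rule LIMSEQ_le_const2[OF tendsto_norm[OF lim]], intro exI allI impI)
      fix M :: nat
      show "norm (\<Sum>k<M. apply_c0 a k *\<^sub>R z k) \<le> norm a * D"
        using D(2)[of "{..<M}" "norm a" "apply_c0 a"] abs_le by (simp add: mult.commute)
    qed
  qed
  moreover have "\<epsilon> / 2 * norm a \<le> norm (S a)" for a
  proof -
    have "\<epsilon> * \<bar>apply_c0 a n\<bar> - norm a * (\<epsilon> / 2) \<le> norm (S a)" for n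
    proof (rule LIMSEQ_le_const[OF tendsto_norm[OF lim]], intro exI allI impI)
      fix M assume M: "M \<ge> Suc n"
      define \<psi> where "\<psi> = \<phi> (r n)"
      define P where "P = (\<Sum>k<M. apply_c0 a k *\<^sub>R z k)"
      define R where "R = (\<Sum>k\<in>{..<M} - {n}. apply_c0 a k * \<psi> (z k))"
      have "\<psi> P = (\<Sum>k<M. apply_c0 a k * \<psi> (z k))"
        by (simp add: P_def blinfun.sum_right blinfun.scaleR_right)
      also have "\<dots> = apply_c0 a n * norm (z n) + R"
        using M by (subst sum.remove[of _ n]) (auto simp: R_def \<psi>_def z_def \<phi>_eq)
      finally have \<psi>P: "\<psi> P = apply_c0 a n * norm (z n) + R" .
      have "\<bar>R\<bar> \<le> (\<Sum>k\<in>{..<M} - {n}. norm a * \<bar>\<psi> (z k)\<bar>)"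
        unfolding R_def by (rule sum_abs[THEN order_trans])
          (auto simp: abs_mult intro!: sum_mono mult_right_mono abs_le)
      also have "\<dots> \<le> norm a * (\<epsilon> / 2)"
        unfolding sum_distrib_left[symmetric] \<psi>_def z_def by (intro mult_left_mono r(2)) auto
      finally have R: "\<bar>R\<bar> \<le> norm a * (\<epsilon> / 2)" .
      have "\<epsilon> * \<bar>apply_c0 a n\<bar> \<le> norm (z n) * \<bar>apply_c0 a n\<bar>"
        unfolding z_def by (intro mult_right_mono below) auto
      also have "\<dots> = \<bar>apply_c0 a n * norm (z n)\<bar>" by (simp add: abs_mult)
      also have "\<dots> \<le> \<bar>\<psi> P\<bar> + norm a * (\<epsilon> / 2)" using \<psi>P R by linarith
      also have "\<bar>\<psi> P\<bar> \<le> norm P" unfolding \<psi>_def by (rule \<phi>_le)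
      finally show "\<epsilon> * \<bar>apply_c0 a n\<bar> - norm a * (\<epsilon> / 2) \<le> norm (\<Sum>k<M. apply_c0 a k *\<^sub>R z k)"
        by (simp add: P_def)
    qed
    then have "norm a \<le> (norm (S a) + norm a * (\<epsilon> / 2)) / \<epsilon>"
      using \<epsilon> by (intro norm_c0_le) (simp add: field_simps)
    then show ?thesis using \<epsilon> by (simp add: field_simps)
  qed
  ultimately show ?thesis
    using \<epsilon> by (intro contains_isomorphicallyI[of S "\<epsilon> / 2"]) auto
qed

text \<open>If the finite partial sums were not Cauchy, disjoint finite blocks with sums bounded away from
  zero would span a copy of \<open>c\<^sub>0\<close>.\<close>

theorem wuc_summable_on:
  fixes y :: "'i \<Rightarrow> 'y::banach"
  assumes y: "wuc y" and no_c0: "\<not> contains_isomorphically TYPE('y) TYPE(null_seq)"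
  shows "y summable_on UNIV"
proof -
  have tail: "\<exists>A. finite A \<and> (\<forall>B. finite B \<longrightarrow> A \<inter> B = {} \<longrightarrow> norm (sum y B) < e)"
    if e: "e > 0" for e
  proof (rule ccontr)
    assume "\<not> ?thesis"
    then have next_block: "\<exists>B. finite B \<and> A \<inter> B = {} \<and> norm (sum y B) \<ge> e" if "finite A" for A
      using that by (meson not_le)
    have "\<exists>A. \<forall>n. finite (A n) \<and> (A n \<subseteq> A (Suc n) \<and> norm (sum y (A (Suc n) - A n)) \<ge> e)"
    proof (rule dependent_nat_choice)
      fix A :: "'i set" assume "finite A"
      then obtain B where B: "finite B" "A \<inter> B = {}" "norm (sum y B) \<ge> e"
        using next_block by blast
      then have "A \<union> B - A = B" by blast
      with B \<open>finite A\<close>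
      show "\<exists>A'. finite A' \<and> A \<subseteq> A' \<and> norm (sum y (A' - A)) \<ge> e"
        by (intro exI[of _ "A \<union> B"]) auto
    qed auto
    then obtain A where A: "\<And>n. finite (A n)" "\<And>n. A n \<subseteq> A (Suc n)"
        "\<And>n. norm (sum y (A (Suc n) - A n)) \<ge> e"
      by blast
    have "wuc (\<lambda>n. sum y (A (Suc n) - A n))"
      using A by (intro wuc_block_sums y disjoint_family_Suc) auto
    from contains_c0_if_wuc[OF this e A(3)] no_c0 show False by contradiction
  qed
  have "cauchy_filter (filtermap (sum y) (finite_subsets_at_top UNIV))"
    unfolding cauchy_filter_metric_filtermap
  proof (intro allI impI)
    fix e :: real assume e: "e > 0"
    then obtain A where A: "finite A" "\<And>B. finite B \<Longrightarrow> A \<inter> B = {} \<Longrightarrow> norm (sum y B) < e / 2"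
      using tail[of "e / 2"] by auto
    define P where "P B \<longleftrightarrow> finite B \<and> A \<subseteq> B" for B
    have "eventually P (finite_subsets_at_top UNIV)"
      using A(1) by (auto simp: P_def eventually_finite_subsets_at_top)
    moreover have near: "dist (sum y B) (sum y A) < e / 2" if "P B" for B
    proof -
      have "sum y B - sum y A = sum y (B - A)"
        using that A(1) by (intro sum_diff[symmetric]) (auto simp: P_def)
      then show ?thesis using A(2)[of "B - A"] that by (auto simp: P_def dist_norm)
    qed
    then have "dist (sum y B) (sum y B') < e" if "P B" "P B'" for B B'
      using dist_triangle_half_l[OF near near] that by blast
    ultimately show "\<exists>P. eventually P (finite_subsets_at_top UNIV) \<and>
        (\<forall>B B'. P B \<and> P B' \<longrightarrow> dist (sum y B) (sum y B') < e)"
      by blast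
  qed
  moreover have "complete (UNIV :: 'y set)"
    by (meson Cauchy_convergent UNIV_I complete_def convergent_def)
  ultimately obtain L where "(sum y \<longlongrightarrow> L) (finite_subsets_at_top UNIV)"
    using complete_uniform[where S = UNIV] by (force simp add: filterlim_def)
  then show ?thesis by (auto simp: summable_on_def has_sum_def)
qed

section \<open>The weak topology\<close>

lemma continuous_map_weak_functional: "continuous_map weak_topology euclideanreal (blinfun_apply \<phi>)"
proof -
  have "openin weak_topology (blinfun_apply \<phi> -` U)" if "open U" for U
    unfolding weak_topology_def by (rule topology_generated_by_Basis) (use that in blast)
  then show ?thesis by (simp add: continuous_map_alt)
qed

lemma continuous_map_into_weak_topology:
  fixes f :: "'a \<Rightarrow> 'y::real_normed_vector"
  assumes "\<And>\<phi> :: 'y \<Rightarrow>\<^sub>L real. continuous_map X euclideanreal (\<lambda>x. \<phi> (f x))"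
  shows "continuous_map X weak_topology f"
  unfolding weak_topology_def
proof (rule continuous_on_generated_topo)
  fix V assume "V \<in> {blinfun_apply \<phi> -` U |(\<phi> :: 'y \<Rightarrow>\<^sub>L real) U. open U}"
  then obtain \<phi> :: "'y \<Rightarrow>\<^sub>L real" and U where "V = blinfun_apply \<phi> -` U" "open U" by blast
  moreover have "f -` blinfun_apply \<phi> -` U = (\<lambda>x. \<phi> (f x)) -` U" by auto
  ultimately show "openin X (f -` V \<inter> topspace X)"
    using assms[of \<phi>] by (simp add: continuous_map_alt)
next
  have "UNIV = blinfun_apply (0 :: 'y \<Rightarrow>\<^sub>L real) -` UNIV" by simp
  then show "f ` topspace X \<subseteq> \<Union> {blinfun_apply \<phi> -` U |(\<phi> :: 'y \<Rightarrow>\<^sub>L real) U. open U}" by blast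
qed

lemma functionals_separate_points:
  fixes x y :: "'y::real_normed_vector"
  assumes "\<And>\<phi> :: 'y \<Rightarrow>\<^sub>L real. \<phi> x = \<phi> y"
  shows "x = y"
proof -
  obtain \<phi> :: "'y \<Rightarrow>\<^sub>L real" where "\<phi> (x - y) = norm (x - y)"
    using norming_functional[of "x - y"] by metis
  then show ?thesis using assms[of \<phi>] by (simp add: blinfun.diff_right)
qed

lemma Hausdorff_space_weak_topology: "Hausdorff_space (weak_topology :: 'y::real_normed_vector topology)"
  unfolding Hausdorff_space_def
proof (intro allI impI)
  fix x y :: 'y
  assume "x \<in> topspace weak_topology \<and> y \<in> topspace weak_topology \<and> x \<noteq> y"
  then obtain \<phi> :: "'y \<Rightarrow>\<^sub>L real" where "\<phi> x \<noteq> \<phi> y"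
    using functionals_separate_points by blast
  then obtain U V where UV: "open U" "open V" "\<phi> x \<in> U" "\<phi> y \<in> V" "U \<inter> V = {}"
    using hausdorff[of "\<phi> x" "\<phi> y"] by blast
  have "openin weak_topology (blinfun_apply \<phi> -` W)" if "open W" for W
    using continuous_map_weak_functional[of \<phi>] that by (simp add: continuous_map_alt)
  then show "\<exists>U V. openin weak_topology U \<and> openin weak_topology V \<and> x \<in> U \<and> y \<in> V \<and> disjnt U V"
    using UV by (intro exI[of _ "blinfun_apply \<phi> -` U"] exI[of _ "blinfun_apply \<phi> -` V"])
      (auto simp: disjnt_def)
qed

lemma closed_if_weakly_compact:
  fixes K :: "'y::real_normed_vector set"
  assumes "compactin weak_topology K"
  shows "closed K"
proof -
  have "closedin weak_topology K"
    by (rule compactin_imp_closedin[OF Hausdorff_space_weak_topology assms])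
  moreover have "continuous_map euclidean weak_topology (\<lambda>x :: 'y. x)"
    by (rule continuous_map_into_weak_topology) (auto intro: continuous_intros)
  ultimately have "closedin euclidean {x \<in> topspace euclidean. x \<in> K}"
    by (intro closedin_continuous_map_preimage)
  then show ?thesis by simp
qed

text \<open>The functions \<open>h\<close> on the dual space that are linear and satisfy \<open>\<bar>h \<phi>\<bar> \<le> norm \<phi>\<close> form a
  closed subset of a product of compact intervals, so they are compact for pointwise convergence.
  By reflexivity each of them is evaluation at a point, and since norming functionals exist, this
  is a unique point of the unit ball. The map from evaluations back to points is weakly continuous
  because its compositions with functionals are coordinate projections.\<close>

theorem weakly_compact_cball_if_reflexive:
  assumes refl: "reflexive_space TYPE('x::real_normed_vector)"
  shows "compactin weak_topology (cball 0 1 :: 'x set)"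
proof -
  define B :: "(('x \<Rightarrow>\<^sub>L real) \<Rightarrow> real) set" where "B = PiE UNIV (\<lambda>\<phi>. cball 0 (norm \<phi>))"
  define L where "L = B \<inter> {h. (\<forall>\<phi> \<psi>. h (\<phi> + \<psi>) = h \<phi> + h \<psi>) \<and> (\<forall>t \<phi>. h (t *\<^sub>R \<phi>) = t * h \<phi>)}"
  have "compact B"
    using compactin_PiE[of "\<lambda>_. euclideanreal" UNIV "\<lambda>\<phi> :: 'x \<Rightarrow>\<^sub>L real. cball 0 (norm \<phi>)"]
    by (simp add: B_def euclidean_product_topology)
  have coord: "continuous_on UNIV (\<lambda>h :: ('x \<Rightarrow>\<^sub>L real) \<Rightarrow> real. h \<phi>)" for \<phi>
    by (rule continuous_on_product_coordinates)
  have "closed {h :: ('x \<Rightarrow>\<^sub>L real) \<Rightarrow> real.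
      (\<forall>\<phi> \<psi>. h (\<phi> + \<psi>) = h \<phi> + h \<psi>) \<and> (\<forall>t \<phi>. h (t *\<^sub>R \<phi>) = t * h \<phi>)}"
    by (intro closed_Collect_conj closed_Collect_all closed_Collect_eq
        continuous_on_add continuous_on_mult continuous_on_const coord)
  with \<open>compact B\<close> have "compact L" unfolding L_def by (rule compact_Int_closed)
  have "\<exists>x. norm x \<le> 1 \<and> (\<forall>\<phi>. h \<phi> = \<phi> x)" if h: "h \<in> L" for h
  proof -
    have abs: "\<bar>h \<phi>\<bar> \<le> norm \<phi>" for \<phi>
      using h by (simp add: L_def B_def PiE_iff)
    have "bounded_linear h"
      using h abs by (intro bounded_linear_intro[where K = 1]) (auto simp: L_def)
    then have "blinfun_apply (Blinfun h) = h" by (rule bounded_linear_Blinfun_apply)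
    moreover obtain x where "canonical_embedding x = Blinfun h"
      using refl unfolding reflexive_space_def by (metis surjD)
    ultimately have x: "h \<phi> = \<phi> x" for \<phi> by (metis canonical_embedding.rep_eq)
    obtain \<phi> :: "'x \<Rightarrow>\<^sub>L real" where \<phi>: "\<And>y. \<bar>\<phi> y\<bar> \<le> norm y" "\<phi> x = norm x"
      using norming_functional[of x] by blast
    have "norm \<phi> \<le> 1" using \<phi>(1) by (intro norm_blinfun_bound) auto
    then have "norm x \<le> 1" using abs[of \<phi>] \<phi>(2) x[of \<phi>] by simp
    with x show ?thesis by blast
  qed
  then obtain point where norm_point: "\<And>h. h \<in> L \<Longrightarrow> norm (point h) \<le> 1"
    and point: "\<And>h \<phi>. h \<in> L \<Longrightarrow> h \<phi> = blinfun_apply \<phi> (point h)"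
    by metis
  have "continuous_map (subtopology euclidean L) weak_topology point"
  proof (rule continuous_map_into_weak_topology)
    fix \<phi> :: "'x \<Rightarrow>\<^sub>L real"
    have "continuous_map (subtopology euclidean L) euclideanreal (\<lambda>h. h \<phi>)"
      by (auto intro: continuous_on_subset[OF continuous_on_product_coordinates])
    then show "continuous_map (subtopology euclidean L) euclideanreal (\<lambda>h. \<phi> (point h))"
      by (rule continuous_map_eq) (simp add: point)
  qed
  moreover have "compactin (subtopology euclidean L) L"
    using \<open>compact L\<close> by (simp add: compactin_subtopology)
  ultimately have "compactin weak_topology (point ` L)" by (intro image_compactin)
  also have "point ` L = cball 0 1"
  proof
    show "point ` L \<subseteq> cball 0 1" using norm_point by auto
    show "cball 0 1 \<subseteq> point ` L"
    proof
      fix x :: 'x assume x: "x \<in> cball 0 1"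
      define h where "h = (\<lambda>\<phi> :: 'x \<Rightarrow>\<^sub>L real. \<phi> x)"
      have "\<bar>h \<phi>\<bar> \<le> norm \<phi>" for \<phi>
      proof -
        have "\<bar>h \<phi>\<bar> \<le> norm \<phi> * norm x" unfolding h_def by (metis norm_blinfun real_norm_def)
        also have "\<dots> \<le> norm \<phi>" using x by (simp add: mult_left_le)
        finally show ?thesis .
      qed
      then have "h \<in> L"
        by (auto simp: L_def B_def h_def blinfun.add_left blinfun.scaleR_left)
      moreover have "point h = x"
        by (rule functionals_separate_points, subst point[OF \<open>h \<in> L\<close>, symmetric]) (simp add: h_def)
      ultimately show "x \<in> point ` L" by blast
    qed
  qed
  finally show ?thesis .
qed

section \<open>Operators on \<open>c\<^sub>0(\<Gamma>, X)\<close>\<close>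

lift_definition c0_single :: "'g \<Rightarrow> 'x \<Rightarrow> ('g, 'x::real_normed_vector) c0"
  is "\<lambda>\<gamma> x \<delta>. if \<delta> = \<gamma> then x else 0"
  unfolding c0_set_def
proof (intro CollectI allI impI)
  fix \<gamma> :: 'g and x :: 'x and e :: real assume "e > 0"
  then have "{\<delta>. norm (if \<delta> = \<gamma> then x else 0) \<ge> e} \<subseteq> {\<gamma>}" by auto
  then show "finite {\<delta>. norm (if \<delta> = \<gamma> then x else 0) \<ge> e}" by (rule finite_subset) simp
qed

lemma apply_c0_sum: "apply_c0 (sum G A) \<delta> = (\<Sum>i\<in>A. apply_c0 (G i) \<delta>)"
  by (induction A rule: infinite_finite_induct) auto

lemma apply_c0_sum_single:
  assumes "finite A"
  shows "apply_c0 (\<Sum>\<gamma>\<in>A. c0_single \<gamma> (F \<gamma>)) \<delta> = (if \<delta> \<in> A then F \<delta> else 0)"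
  using assms by (simp add: apply_c0_sum c0_single.rep_eq)

lemma norm_c0_sum_single_le:
  assumes "finite A" "b \<ge> 0" "\<And>\<gamma>. \<gamma> \<in> A \<Longrightarrow> norm (F \<gamma>) \<le> b"
  shows "norm (\<Sum>\<gamma>\<in>A. c0_single \<gamma> (F \<gamma>)) \<le> b"
  using assms by (intro norm_c0_le) (simp add: apply_c0_sum_single)

lemma bounded_linear_c0_single: "bounded_linear (c0_single \<gamma>)"
proof (rule bounded_linear_intro[where K = 1])
  show "norm (c0_single \<gamma> x) \<le> norm x * 1" for x
    using norm_c0_le[of "c0_single \<gamma> x" "norm x"] by (simp add: c0_single.rep_eq)
qed (auto intro!: c0_eqI simp: c0_single.rep_eq)

lemma has_sum_c0_single: "((\<lambda>\<gamma>. c0_single \<gamma> (apply_c0 F \<gamma>)) has_sum F) UNIV"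
  unfolding has_sum_def tendsto_iff eventually_finite_subsets_at_top
proof (intro allI impI)
  fix e :: real assume e: "e > 0"
  define A where "A = {\<gamma>. norm (apply_c0 F \<gamma>) \<ge> e / 2}"
  have "finite A" unfolding A_def using e by (intro c0_setD apply_c0) simp
  moreover have "dist (\<Sum>\<gamma>\<in>B. c0_single \<gamma> (apply_c0 F \<gamma>)) F < e" if "finite B" "A \<subseteq> B" for B
  proof -
    have "norm ((\<Sum>\<gamma>\<in>B. c0_single \<gamma> (apply_c0 F \<gamma>)) - F) \<le> e / 2"
      using that e by (intro norm_c0_le) (force simp: apply_c0_sum_single A_def)
    then show ?thesis using e by (simp add: dist_norm)
  qed
  ultimately show "\<exists>A. finite A \<and> A \<subseteq> UNIV \<and> (\<forall>B. finite B \<and> A \<subseteq> B \<and> B \<subseteq> UNIV \<longrightarrow>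
      dist (\<Sum>\<gamma>\<in>B. c0_single \<gamma> (apply_c0 F \<gamma>)) F < e)"
    by blast
qed

lemma wuc_c0_single:
  fixes T :: "('g, 'x::real_normed_vector) c0 \<Rightarrow> 'y::real_normed_vector"
  assumes T: "bounded_linear T" and F: "\<And>\<gamma>. norm (F \<gamma>) \<le> 1"
  shows "wuc (\<lambda>\<gamma>. T (c0_single \<gamma> (F \<gamma>)))"
proof (rule wucI[where C = "onorm T * 1"])
  interpret T: bounded_linear T by fact
  fix A and a :: "'g \<Rightarrow> real" assume A: "finite A" "\<And>\<gamma>. \<gamma> \<in> A \<Longrightarrow> \<bar>a \<gamma>\<bar> \<le> 1"
  have "a \<gamma> *\<^sub>R T (c0_single \<gamma> (F \<gamma>)) = T (c0_single \<gamma> (a \<gamma> *\<^sub>R F \<gamma>))" for \<gamma>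
    by (simp add: T.scaleR bounded_linear.linear[OF bounded_linear_c0_single] linear_scale)
  then have "(\<Sum>\<gamma>\<in>A. a \<gamma> *\<^sub>R T (c0_single \<gamma> (F \<gamma>))) = T (\<Sum>\<gamma>\<in>A. c0_single \<gamma> (a \<gamma> *\<^sub>R F \<gamma>))"
    by (simp add: T.sum)
  also have "norm \<dots> \<le> onorm T * norm (\<Sum>\<gamma>\<in>A. c0_single \<gamma> (a \<gamma> *\<^sub>R F \<gamma>))"
    by (rule onorm[OF T])
  also have "\<dots> \<le> onorm T * 1"
    using A F by (intro mult_left_mono norm_c0_sum_single_le onorm_pos_le T)
      (auto intro: mult_le_one)
  finally show "norm (\<Sum>\<gamma>\<in>A. a \<gamma> *\<^sub>R T (c0_single \<gamma> (F \<gamma>))) \<le> onorm T * 1" .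
qed

text \<open>The bound makes the supremum of the finite sums finite. Take \<open>A\<close> and \<open>F\<close> with a sum within \<open>e\<close> of the supremum. Since the coordinates of \<open>F\<close> off \<open>A\<close> may be
  replaced by any others in the unit ball, no disjoint \<open>B\<close> can contribute more than \<open>e\<close>. As each \<open>\<psi> \<gamma>\<close> is odd, this also
  bounds the sums over \<open>B\<close> from below.\<close>

lemma uniformly_small_tails:
  fixes \<psi> :: "'g \<Rightarrow> 'x::real_normed_vector \<Rightarrow> real"
  assumes odd: "\<And>\<gamma> x. \<psi> \<gamma> (- x) = - \<psi> \<gamma> x"
    and bound: "\<And>A F. finite A \<Longrightarrow> (\<And>\<gamma>. norm (F \<gamma>) \<le> 1) \<Longrightarrow> (\<Sum>\<gamma>\<in>A. \<psi> \<gamma> (F \<gamma>)) \<le> C"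
    and e: "e > 0"
  obtains A where "finite A"
    "\<And>B F. finite B \<Longrightarrow> A \<inter> B = {} \<Longrightarrow> (\<And>\<gamma>. norm (F \<gamma>) \<le> 1) \<Longrightarrow> \<bar>\<Sum>\<gamma>\<in>B. \<psi> \<gamma> (F \<gamma>)\<bar> \<le> e"
proof -
  define V where "V = {\<Sum>\<gamma>\<in>A. \<psi> \<gamma> (F \<gamma>) | A F. finite A \<and> (\<forall>\<gamma>. norm (F \<gamma>) \<le> 1)}"
  have "(\<Sum>\<gamma>\<in>{}. \<psi> \<gamma> 0) \<in> V" unfolding V_def by (intro CollectI exI[of _ "{}"] exI[of _ "\<lambda>_. 0"]) auto
  then have "V \<noteq> {}" by blast
  have bdd: "bdd_above V" unfolding V_def bdd_above_def using bound by blast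
  obtain v where "v \<in> V" "Sup V - e < v"
    using less_cSup_iff[OF \<open>V \<noteq> {}\<close> bdd, of "Sup V - e"] e by auto
  then obtain A F where A: "finite A" and F: "\<And>\<gamma>. norm (F \<gamma>) \<le> 1"
    and near: "Sup V - e < (\<Sum>\<gamma>\<in>A. \<psi> \<gamma> (F \<gamma>))"
    unfolding V_def by blast
  have le: "(\<Sum>\<gamma>\<in>B. \<psi> \<gamma> (G \<gamma>)) \<le> e" if B: "finite B" "A \<inter> B = {}" and G: "\<And>\<gamma>. norm (G \<gamma>) \<le> 1" for B G
  proof -
    define H where "H \<gamma> = (if \<gamma> \<in> A then F \<gamma> else G \<gamma>)" for \<gamma>
    have "(\<Sum>\<gamma>\<in>A. \<psi> \<gamma> (F \<gamma>)) + (\<Sum>\<gamma>\<in>B. \<psi> \<gamma> (G \<gamma>)) = (\<Sum>\<gamma>\<in>A. \<psi> \<gamma> (H \<gamma>)) + (\<Sum>\<gamma>\<in>B. \<psi> \<gamma> (H \<gamma>))"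
      using B by (intro arg_cong2[where f = "(+)"] sum.cong) (auto simp: H_def)
    also have "\<dots> = (\<Sum>\<gamma>\<in>A \<union> B. \<psi> \<gamma> (H \<gamma>))"
      using A B by (intro sum.union_disjoint[symmetric])
    also have "\<dots> \<le> Sup V"
      using A B F G by (intro cSup_upper[OF _ bdd]) (force simp: V_def H_def)
    finally show ?thesis using near by simp
  qed
  have "\<bar>\<Sum>\<gamma>\<in>B. \<psi> \<gamma> (G \<gamma>)\<bar> \<le> e" if "finite B" "A \<inter> B = {}" "\<And>\<gamma>. norm (G \<gamma>) \<le> 1" for B G
    using le[OF that(1,2), of G] le[OF that(1,2), of "\<lambda>\<gamma>. - G \<gamma>"] that(3)
    by (simp add: odd sum_negf)
  with A show ?thesis by (rule that)
qed

text \<open>This is the value at \<open>F\<close> of an extension of \<open>T\<close> from \<open>c\<^sub>0(\<Gamma>, X)\<close> to bounded functions. When the sums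
  converge, the extension is the restriction to \<open>\<ell>\<^sub>\<infinity>(\<Gamma>, X)\<close> of the second adjoint of \<open>T\<close>.\<close>

definition bounded_extension :: "(('g, 'x::real_normed_vector) c0 \<Rightarrow> 'y::banach) \<Rightarrow> ('g \<Rightarrow> 'x) \<Rightarrow> 'y" where
  "bounded_extension T F = (\<Sum>\<^sub>\<infinity>\<gamma>. T (c0_single \<gamma> (F \<gamma>)))"

lemma has_sum_bounded_extension:
  fixes T :: "('g, 'x::real_normed_vector) c0 \<Rightarrow> 'y::banach"
  assumes "bounded_linear T" and "\<not> contains_isomorphically TYPE('y) TYPE(null_seq)"
    and "\<And>\<gamma>. norm (F \<gamma>) \<le> 1"
  shows "((\<lambda>\<gamma>. T (c0_single \<gamma> (F \<gamma>))) has_sum bounded_extension T F) UNIV"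
  unfolding bounded_extension_def
  by (intro has_sum_infsum wuc_summable_on wuc_c0_single assms)

lemma bounded_extension_apply_c0:
  fixes T :: "('g, 'x::real_normed_vector) c0 \<Rightarrow> 'y::banach"
  assumes "bounded_linear T"
  shows "bounded_extension T (apply_c0 F) = T F"
  unfolding bounded_extension_def
  using has_sum_bounded_linear[OF assms has_sum_c0_single] by (rule infsumI)

text \<open>Composed with a functional, the extension is a uniform limit of finite sums on the unit ball,
  because the tails are uniformly small. Each finite sum depends weakly continuously on finitely
  many coordinates.\<close>

lemma continuous_map_bounded_extension:
  fixes T :: "('g, 'x::real_normed_vector) c0 \<Rightarrow> 'y::banach"
  assumes T: "bounded_linear T" and no_c0: "\<not> contains_isomorphically TYPE('y) TYPE(null_seq)"
  defines "X \<equiv> subtopology (product_topology (\<lambda>_. weak_topology) UNIV) (PiE UNIV (\<lambda>_. cball 0 1))"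
  shows "continuous_map X weak_topology (bounded_extension T)"
proof (rule continuous_map_into_weak_topology)
  fix \<phi> :: "'y \<Rightarrow>\<^sub>L real"
  define \<psi> where "\<psi> \<gamma> = Blinfun (\<lambda>x. \<phi> (T (c0_single \<gamma> x)))" for \<gamma>
  have bl: "bounded_linear (\<lambda>F. \<phi> (T F))"
    by (rule bounded_linear_compose[OF blinfun.bounded_linear_right T])
  have \<psi>: "blinfun_apply (\<psi> \<gamma>) x = \<phi> (T (c0_single \<gamma> x))" for \<gamma> x
    unfolding \<psi>_def
    using bounded_linear_Blinfun_apply[OF bounded_linear_compose[OF bl bounded_linear_c0_single]]
    by metis
  have top: "F \<in> topspace X \<longleftrightarrow> (\<forall>\<gamma>. norm (F \<gamma>) \<le> 1)" for F
    by (auto simp: X_def PiE_iff)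
  have sum_\<psi>: "(\<Sum>\<gamma>\<in>A. \<psi> \<gamma> (F \<gamma>)) \<le> onorm (\<lambda>F. \<phi> (T F))"
    if "finite A" "\<And>\<gamma>. norm (F \<gamma>) \<le> 1" for A F
  proof -
    have "(\<Sum>\<gamma>\<in>A. \<psi> \<gamma> (F \<gamma>)) = \<phi> (T (\<Sum>\<gamma>\<in>A. c0_single \<gamma> (F \<gamma>)))"
      by (simp add: \<psi> linear_sum[OF bounded_linear.linear[OF bl]])
    also have "\<dots> \<le> onorm (\<lambda>F. \<phi> (T F)) * norm (\<Sum>\<gamma>\<in>A. c0_single \<gamma> (F \<gamma>))"
      using onorm[OF bl, of "\<Sum>\<gamma>\<in>A. c0_single \<gamma> (F \<gamma>)"] by simp
    also have "\<dots> \<le> onorm (\<lambda>F. \<phi> (T F)) * 1"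
      using that by (intro mult_left_mono norm_c0_sum_single_le onorm_pos_le bl) auto
    finally show ?thesis by simp
  qed
  have "continuous_map X Met_TC.mtopology (\<lambda>F. \<phi> (bounded_extension T F))"
  proof (rule Met_TC.continuous_map_uniform_limit)
    show "\<forall>\<^sub>F A in finite_subsets_at_top UNIV. continuous_map X Met_TC.mtopology (\<lambda>F. \<Sum>\<gamma>\<in>A. \<psi> \<gamma> (F \<gamma>))"
    proof (rule eventually_finite_subsets_at_top_weakI)
      fix A :: "'g set" assume "finite A"
      have "continuous_map X weak_topology (\<lambda>F. F \<gamma>)" for \<gamma>
        unfolding X_def by (intro continuous_map_from_subtopology continuous_map_product_projection) simp
      then have "continuous_map X euclideanreal (\<lambda>F. \<psi> \<gamma> (F \<gamma>))" for \<gamma>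
        using continuous_map_compose[OF _ continuous_map_weak_functional] by (force simp: o_def)
      then show "continuous_map X Met_TC.mtopology (\<lambda>F. \<Sum>\<gamma>\<in>A. \<psi> \<gamma> (F \<gamma>))"
        using \<open>finite A\<close> by (simp add: continuous_map_sum)
    qed
    fix e :: real assume e: "e > 0"
    obtain A where A: "finite A" "\<And>B F. finite B \<Longrightarrow> A \<inter> B = {} \<Longrightarrow> (\<And>\<gamma>. norm (F \<gamma>) \<le> 1) \<Longrightarrow>
        \<bar>\<Sum>\<gamma>\<in>B. \<psi> \<gamma> (F \<gamma>)\<bar> \<le> e / 2"
      using uniformly_small_tails[of "\<lambda>\<gamma>. blinfun_apply (\<psi> \<gamma>)", OF blinfun.minus_right sum_\<psi>, of "e / 2"] e
      by (metis half_gt_zero)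
    have "dist (\<Sum>\<gamma>\<in>A'. \<psi> \<gamma> (F \<gamma>)) (\<phi> (bounded_extension T F)) < e"
      if A': "finite A'" "A \<subseteq> A'" and F: "\<And>\<gamma>. norm (F \<gamma>) \<le> 1" for A' F
    proof -
      have "((\<lambda>\<gamma>. \<psi> \<gamma> (F \<gamma>)) has_sum \<phi> (bounded_extension T F)) UNIV"
        using has_sum_bounded_linear[OF blinfun.bounded_linear_right has_sum_bounded_extension[OF T no_c0 F]]
        by (simp add: \<psi>)
      then have "((\<lambda>B. dist (\<Sum>\<gamma>\<in>A'. \<psi> \<gamma> (F \<gamma>)) (\<Sum>\<gamma>\<in>B. \<psi> \<gamma> (F \<gamma>))) \<longlongrightarrow>
          dist (\<Sum>\<gamma>\<in>A'. \<psi> \<gamma> (F \<gamma>)) (\<phi> (bounded_extension T F))) (finite_subsets_at_top UNIV)"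
        unfolding has_sum_def by (intro tendsto_dist tendsto_const)
      moreover have "\<forall>\<^sub>F B in finite_subsets_at_top UNIV.
          dist (\<Sum>\<gamma>\<in>A'. \<psi> \<gamma> (F \<gamma>)) (\<Sum>\<gamma>\<in>B. \<psi> \<gamma> (F \<gamma>)) \<le> e / 2"
        unfolding eventually_finite_subsets_at_top
      proof (intro exI[of _ A'] conjI allI impI)
        fix B assume B: "finite B \<and> A' \<subseteq> B \<and> B \<subseteq> UNIV"
        then have "(\<Sum>\<gamma>\<in>B. \<psi> \<gamma> (F \<gamma>)) - (\<Sum>\<gamma>\<in>A'. \<psi> \<gamma> (F \<gamma>)) = (\<Sum>\<gamma>\<in>B - A'. \<psi> \<gamma> (F \<gamma>))"
          using A'(1) by (intro sum_diff[symmetric]) auto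
        moreover have "\<bar>\<Sum>\<gamma>\<in>B - A'. \<psi> \<gamma> (F \<gamma>)\<bar> \<le> e / 2"
          using B A'(2) F by (intro A(2)) auto
        ultimately show "dist (\<Sum>\<gamma>\<in>A'. \<psi> \<gamma> (F \<gamma>)) (\<Sum>\<gamma>\<in>B. \<psi> \<gamma> (F \<gamma>)) \<le> e / 2"
          by (simp only: dist_real_def abs_minus_commute)
      qed (use A' in auto)
      ultimately have "dist (\<Sum>\<gamma>\<in>A'. \<psi> \<gamma> (F \<gamma>)) (\<phi> (bounded_extension T F)) \<le> e / 2"
        by (rule tendsto_upperbound) simp
      with e show ?thesis by simp
    qed
    then show "\<forall>\<^sub>F A' in finite_subsets_at_top UNIV. \<forall>F\<in>topspace X.
        \<phi> (bounded_extension T F) \<in> UNIV \<and> dist (\<Sum>\<gamma>\<in>A'. \<psi> \<gamma> (F \<gamma>)) (\<phi> (bounded_extension T F)) < e"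
      unfolding eventually_finite_subsets_at_top using A(1)
      by (intro exI[of _ A] conjI allI impI ballI UNIV_I) (auto simp: top)
  qed simp
  then show "continuous_map X euclideanreal (\<lambda>F. \<phi> (bounded_extension T F))" by simp
qed

lemma bounded_extension_cball_eq_closure:
  fixes T :: "('g, 'x::real_normed_vector) c0 \<Rightarrow> 'y::banach"
  assumes T: "bounded_linear T" and no_c0: "\<not> contains_isomorphically TYPE('y) TYPE(null_seq)"
    and closed: "closed (bounded_extension T ` PiE UNIV (\<lambda>_. cball 0 1))"
  shows "bounded_extension T ` PiE UNIV (\<lambda>_. cball 0 1) = closure (T ` cball 0 1)"
proof
  show "closure (T ` cball 0 1) \<subseteq> bounded_extension T ` PiE UNIV (\<lambda>_. cball 0 1)"
  proof (rule closure_minimal[OF _ closed], rule image_subsetI)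
    fix F :: "('g, 'x) c0" assume "F \<in> cball 0 1"
    then have "apply_c0 F \<in> PiE UNIV (\<lambda>_. cball 0 1)"
      using order_trans[OF norm_apply_c0_le, of F 1] by auto
    then show "T F \<in> bounded_extension T ` PiE UNIV (\<lambda>_. cball 0 1)"
      using bounded_extension_apply_c0[OF T, of F] by (metis imageI)
  qed
  show "bounded_extension T ` PiE UNIV (\<lambda>_. cball 0 1) \<subseteq> closure (T ` cball 0 1)"
  proof (rule image_subsetI)
    fix F :: "'g \<Rightarrow> 'x" assume "F \<in> PiE UNIV (\<lambda>_. cball 0 1)"
    then have F: "norm (F \<gamma>) \<le> 1" for \<gamma> by (auto simp: PiE_iff)
    have "((\<lambda>A. \<Sum>\<gamma>\<in>A. T (c0_single \<gamma> (F \<gamma>))) \<longlongrightarrow> bounded_extension T F) (finite_subsets_at_top UNIV)"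
      using has_sum_bounded_extension[OF T no_c0 F] by (simp add: has_sum_def)
    moreover have "(\<Sum>\<gamma>\<in>A. T (c0_single \<gamma> (F \<gamma>))) \<in> closure (T ` cball 0 1)" if "finite A" for A
    proof -
      have "(\<Sum>\<gamma>\<in>A. T (c0_single \<gamma> (F \<gamma>))) = T (\<Sum>\<gamma>\<in>A. c0_single \<gamma> (F \<gamma>))"
        by (simp add: linear_sum[OF bounded_linear.linear[OF T]])
      moreover have "(\<Sum>\<gamma>\<in>A. c0_single \<gamma> (F \<gamma>)) \<in> cball 0 1"
        using norm_c0_sum_single_le[of A 1 F] that F by simp
      ultimately show ?thesis using closure_subset by fastforce
    qed
    ultimately show "bounded_extension T F \<in> closure (T ` cball 0 1)"
      by (intro Lim_in_closed_set[OF closed_closure _ finite_subsets_at_top_neq_bot])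
        (auto intro: eventually_finite_subsets_at_top_weakI)
  qed
qed

theorem theorem2p3:
  fixes T :: "('g, 'x::banach) c0 \<Rightarrow> 'y::banach"
  assumes "(UNIV :: 'x set) \<noteq> {0}"
    and "(UNIV :: 'y set) \<noteq> {0}"
    and "reflexive_space TYPE('x)"
    and "\<not> contains_isomorphically TYPE('y) TYPE(null_seq)"
    and "bounded_linear T"
  shows "weakly_compact_operator T"
proof -
  let ?B = "PiE UNIV (\<lambda>_. cball 0 1) :: ('g \<Rightarrow> 'x) set"
  let ?P = "product_topology (\<lambda>_. weak_topology) UNIV :: ('g \<Rightarrow> 'x) topology"
  have "compactin ?P ?B"
    using weakly_compact_cball_if_reflexive[OF assms(3)] by (simp add: compactin_PiE)
  then have "compactin (subtopology ?P ?B) ?B"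
    by (simp add: compactin_subtopology)
  then have compact: "compactin weak_topology (bounded_extension T ` ?B)"
    using continuous_map_bounded_extension[OF assms(5,4)] by (rule image_compactin)
  have "bounded_extension T ` ?B = closure (T ` cball 0 1)"
    by (rule bounded_extension_cball_eq_closure[OF assms(5,4) closed_if_weakly_compact[OF compact]])
  with compact show ?thesis by (simp add: weakly_compact_operator_def)
qed

end
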